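(* Let $X$ be a Cantor space and let $\{ p_{n+1,n} : (I_{n+1},\phi_{n+1}) \to (I_n,\phi_n) : n\in\mathbb{N} \}$ be a pointed Shimomura sequence. The set of $f \in C_s(X)$ which satisfy the lifting property with respect to the sequence is a $G_{\delta}$ subset of $C_s(X)$. If this set is nonempty then it is exactly the set of $f \in C_s(X)$ which are conjugate to the inverse limit $(I_\infty,\phi_\infty)$ of the sequence.
   Context: A Cantor space is a nonempty, compact, zero-dimensional, perfect metric space. $C_s(X)$ is the space of continuous surjections $X\to X$ with the sup metric. $\mathbb{N}$ is the set of positive integers; $\mathcal{I}$ is the set of all nonempty finite subsets of $\mathbb{N}^n$, $n=1,2,\dots$ (discrete). A system $(A,R)$ is a compact metric space $A$ with a closed relation $R\subset A\times A$ that is surjective (both projections onto $A$); maps are identified with their graphs. A system surjection $p:(A,R)\to(B,S)$ is a continuous surjection $p:A\to B$ with $(p\times p)(R)=S$. A Shimomura sequence is a sequence of system surjections $p_{n+1,n}:(I_{n+1},\phi_{n+1})\to(I_n,\phi_n)$, $n\in\mathbb{N}$, with all $I_n\in\mathcal{I}$, $\phi_n$ surjective relations, such that, with $p_{m,n}=p_{n+1,n}\circ\cdots\circ p_{m,m-1}$ for $m>n$: (bifurcation) for every $n$ and $x\in I_n$ there are $m>n$ and $y_1\ne y_2$ in $I_m$ with $p_{m,n}(y_1)=p_{m,n}(y_2)=x$; (Shimomura Condition) for every $n$ there is $m>n$ such that $p_{m,n}\circ\phi_m=\{(a,p_{m,n}(b)):(a,b)\in\phi_m\}$ is a map $I_m\to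 I_n$. It is pointed if $I_1$ is a singleton. Its inverse limit is $I_\infty=\{z\in\prod_n I_n: z_n=p_{n+1,n}(z_{n+1})\ \forall n\}$ with $\phi_\infty=\{(x,y)\in I_\infty\times I_\infty:(x_n,y_n)\in\phi_n\ \forall n\}$; here $I_\infty$ is a Cantor space and $\phi_\infty$ is a continuous surjection on it. Maps $f$ on $X$ and $g$ on $Y$ are conjugate if $g=h\circ f\circ h^{-1}$ for some homeomorphism $h:X\to Y$. The mesh of a continuous map $\beta:X\to J$, $J$ finite, is $\max\{d(x,y):\beta(x)=\beta(y)\}$. $f\in C_s(X)$ satisfies the lifting property with respect to the pointed Shimomura sequence if for every $\epsilon>0$, $n\in\mathbb{N}$ and every system surjection $\alpha:(X,f)\to(I_n,\phi_n)$ there exist $m>n$ and a system surjection $\beta:(X,f)\to(I_m,\phi_m)$ with $\alpha=p_{m,n}\circ\beta$ and mesh of $\beta$ less than $\epsilon$. *)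

theory Defs
  imports "HOL-Analysis.Analysis"
begin

text \<open>Zero-dimensional means that the relatively clopen sets form a base.\<close>

definition Cantor_space :: "'a::metric_space set \<Rightarrow> bool" where
  "Cantor_space X \<longleftrightarrow>
     X \<noteq> {} \<and> compact X \<and>
     (\<forall>U x. openin (top_of_set X) U \<and> x \<in> U \<longrightarrow>
        (\<exists>V. openin (top_of_set X) V \<and> closedin (top_of_set X) V \<and> x \<in> V \<and> V \<subseteq> U)) \<and>
     (\<forall>x\<in>X. x islimpt X)"

text \<open>
  On a compact space every continuous map is bounded, so the bounded continuous functions are all
  the continuous maps, and \<^term>\<open>dist\<close> on them is the sup metric.
\<close>

definition continuous_surjections :: "('a::metric_space \<Rightarrow>\<^sub>C 'a) set" where
  "continuous_surjections = {f. surj (apply_bcontfun f)}"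

definition graph_on :: "'a set \<Rightarrow> ('a \<Rightarrow> 'b) \<Rightarrow> ('a \<times> 'b) set" where
  "graph_on A f = {(x, f x) | x. x \<in> A}"

definition is_system :: "'a topology \<Rightarrow> ('a \<times> 'a) set \<Rightarrow> bool" where
  "is_system A R \<longleftrightarrow>
     compact_space A \<and> metrizable_space A \<and> closedin (prod_topology A A) R \<and>
     fst ` R = topspace A \<and> snd ` R = topspace A"

definition system_surjection ::
  "'a topology \<Rightarrow> ('a \<times> 'a) set \<Rightarrow> 'b topology \<Rightarrow> ('b \<times> 'b) set \<Rightarrow> ('a \<Rightarrow> 'b) \<Rightarrow> bool" where
  "system_surjection A R B S p \<longleftrightarrow>
     is_system A R \<and> is_system B S \<and>
     continuous_map A B p \<and> p ` topspace A = topspace B \<and> map_prod p p ` R = S"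

text \<open>
  Points of the \<open>k\<close>-fold power of the positive integers are lists of length \<open>k\<close> with positive
  entries; the power \<open>k\<close> may vary with the set.
\<close>

definition index_sets :: "nat list set set" where
  "index_sets =
     {A. finite A \<and> A \<noteq> {} \<and>
         (\<exists>k\<ge>1. A \<subseteq> {xs. length xs = k \<and> (\<forall>i\<in>set xs. 1 \<le> i)})}"

text \<open>
  In a sequence, \<open>p n\<close> is the map from \<open>I (n + 1)\<close> to \<open>I n\<close>, and only indices
  \<open>n \<ge> 1\<close> are relevant. For \<open>m > n\<close>, \<open>bond p m n\<close> is the composite
  \<open>p n \<circ> \<dots> \<circ> p (m - 1)\<close> from \<open>I m\<close> to \<open>I n\<close>; for \<open>m \<le> n\<close> it is the identity.
\<close>

primrec bond :: "(nat \<Rightarrow> 'b \<Rightarrow> 'b) \<Rightarrow> nat \<Rightarrow> nat \<Rightarrow> 'b \<Rightarrow> 'b" where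
  "bond p 0 n = id"
| "bond p (Suc m) n = (if n \<le> m then bond p m n \<circ> p m else id)"

definition Shimomura_sequence ::
  "(nat \<Rightarrow> nat list set) \<Rightarrow> (nat \<Rightarrow> (nat list \<times> nat list) set) \<Rightarrow>
   (nat \<Rightarrow> nat list \<Rightarrow> nat list) \<Rightarrow> bool" where
  "Shimomura_sequence I \<phi> p \<longleftrightarrow>
     (\<forall>n\<ge>1. I n \<in> index_sets) \<and>
     (\<forall>n\<ge>1. system_surjection (discrete_topology (I (n + 1))) (\<phi> (n + 1))
              (discrete_topology (I n)) (\<phi> n) (p n)) \<and>
     (\<forall>n\<ge>1. \<forall>x\<in>I n. \<exists>m>n. \<exists>y1\<in>I m. \<exists>y2\<in>I m.
        y1 \<noteq> y2 \<and> bond p m n y1 = x \<and> bond p m n y2 = x) \<and>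
     (\<forall>n\<ge>1. \<exists>m>n. \<exists>g \<in> I m \<rightarrow> I n.
        {(a, bond p m n b) | a b. (a, b) \<in> \<phi> m} = graph_on (I m) g)"

definition pointed_Shimomura_sequence ::
  "(nat \<Rightarrow> nat list set) \<Rightarrow> (nat \<Rightarrow> (nat list \<times> nat list) set) \<Rightarrow>
   (nat \<Rightarrow> nat list \<Rightarrow> nat list) \<Rightarrow> bool" where
  "pointed_Shimomura_sequence I \<phi> p \<longleftrightarrow> Shimomura_sequence I \<phi> p \<and> is_singleton (I 1)"

definition inverse_limit_set ::
  "(nat \<Rightarrow> 'b set) \<Rightarrow> (nat \<Rightarrow> 'b \<Rightarrow> 'b) \<Rightarrow> (nat \<Rightarrow> 'b) set" where
  "inverse_limit_set I p = {z \<in> Pi\<^sub>E {1..} I. \<forall>n\<ge>1. z n = p n (z (n + 1))}"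

definition inverse_limit_topology ::
  "(nat \<Rightarrow> 'b set) \<Rightarrow> (nat \<Rightarrow> 'b \<Rightarrow> 'b) \<Rightarrow> (nat \<Rightarrow> 'b) topology" where
  "inverse_limit_topology I p =
     subtopology (product_topology (\<lambda>n. discrete_topology (I n)) {1..}) (inverse_limit_set I p)"

definition inverse_limit_relation ::
  "(nat \<Rightarrow> 'b set) \<Rightarrow> (nat \<Rightarrow> ('b \<times> 'b) set) \<Rightarrow> (nat \<Rightarrow> 'b \<Rightarrow> 'b) \<Rightarrow>
   ((nat \<Rightarrow> 'b) \<times> (nat \<Rightarrow> 'b)) set" where
  "inverse_limit_relation I \<phi> p =
     {(x, y). x \<in> inverse_limit_set I p \<and> y \<in> inverse_limit_set I p \<and>
              (\<forall>n\<ge>1. (x n, y n) \<in> \<phi> n)}"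

text \<open>
  The map on the target space \<open>Y\<close> is given by its graph \<open>G\<close>; \<open>k\<close> is the inverse of
  the homeomorphism \<open>h\<close>.
\<close>

definition conjugate_to ::
  "'a topology \<Rightarrow> ('a \<Rightarrow> 'a) \<Rightarrow> 'b topology \<Rightarrow> ('b \<times> 'b) set \<Rightarrow> bool" where
  "conjugate_to X f Y G \<longleftrightarrow>
     (\<exists>h k. homeomorphic_maps X Y h k \<and> G = graph_on (topspace Y) (h \<circ> f \<circ> k))"

text \<open>
  For a continuous map from a compact space to a finite discrete one this supremum is attained,
  hence is the maximum.
\<close>

definition mesh :: "('a::metric_space \<Rightarrow> 'b) \<Rightarrow> real" where
  "mesh \<beta> = Sup {dist x y | x y. \<beta> x = \<beta> y}"

definition lifting_property ::
  "(nat \<Rightarrow> 'b set) \<Rightarrow> (nat \<Rightarrow> ('b \<times> 'b) set) \<Rightarrow> (nat \<Rightarrow> 'b \<Rightarrow> 'b) \<Rightarrow>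
   ('a::metric_space \<Rightarrow> 'a) \<Rightarrow> bool" where
  "lifting_property I \<phi> p f \<longleftrightarrow>
     (\<forall>\<epsilon>>0. \<forall>n\<ge>1. \<forall>\<alpha>.
        system_surjection euclidean (graph_on UNIV f) (discrete_topology (I n)) (\<phi> n) \<alpha> \<longrightarrow>
        (\<exists>m>n. \<exists>\<beta>.
           system_surjection euclidean (graph_on UNIV f) (discrete_topology (I m)) (\<phi> m) \<beta> \<and>
           \<alpha> = bond p m n \<circ> \<beta> \<and> mesh \<beta> < \<epsilon>))"

end

theory Submission
  imports Defs
begin

text \<open>
  A system surjection from \<open>(X, f)\<close> onto a finite system is a clopen partition of \<open>X\<close>
  whose labels follow prescribed transitions under \<open>f\<close>. On a compact space such a partition has
  cells at positive distance from each other, so a uniformly small change of \<open>f\<close> leaves every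
  transition unaltered: for a fixed labelling, being a system surjection is an open and closed condition
  on \<open>f\<close> (\<open>openin_system_surjection\<close>). The lifting property quantifies over all
  labellings \<open>\<alpha>\<close>, of which there may be infinitely many, but only finitely many share a given
  modulus of local constancy. Hence it is a countable intersection of open conditions
  (\<open>gdelta_in_lifting_property\<close>).

  For the second part, let \<open>f\<close> have the lifting property. Because the sequence is pointed, the constant
  map onto the singleton \<open>I 1\<close> is a system surjection, and lifting it repeatedly with accuracies
  tending to \<open>0\<close> gives a tower of compatible labellings
  (\<open>obtain_tower_of_lifts\<close>). Together they form a continuous map from \<open>X\<close> to the inverse
  limit, injective since the meshes vanish and onto by compactness, hence a homeomorphism. It carries
  \<open>f\<close> into the limit relation, and the Shimomura Condition makes that relation single valued, so
  it is the graph of the transported map (\<open>lifting_imp_conjugate_to_inverse_limit\<close>).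

  Conversely, if one map with the lifting property exists, it is conjugate to the inverse limit, and so
  every map conjugate to the inverse limit is conjugate to it. The lifting property passes along
  conjugacies (\<open>lifting_property_conjugate\<close>). The nonemptiness assumption enters here:
  nothing else provides lifts for the inverse limit itself.
\<close>

section \<open>Maps from a compact space onto finite systems\<close>

lemma mesh_less_imp_dist_less:
  fixes \<beta> :: "'a::metric_space \<Rightarrow> 'b"
  assumes "compact (UNIV :: 'a set)" "mesh \<beta> < e" "\<beta> x = \<beta> y"
  shows "dist x y < e"
proof -
  obtain B where "\<And>x y :: 'a. dist x y \<le> B"
    using compact_imp_bounded[OF assms(1)] unfolding bounded_two_points by blast
  then have "bdd_above {dist x y | x y. \<beta> x = \<beta> y}"
    by (auto simp: bdd_above_def)
  then have "dist x y \<le> mesh \<beta>"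
    unfolding mesh_def using assms(3) by (intro cSup_upper) auto
  with assms(2) show ?thesis by simp
qed

lemma mesh_leI:
  assumes "\<And>x y. \<beta> x = \<beta> y \<Longrightarrow> dist x y \<le> e"
  shows "mesh \<beta> \<le> e"
  unfolding mesh_def by (rule cSup_least) (use assms in auto)

lemma continuous_map_discrete_iff_open_fibres:
  fixes \<beta> :: "'a::topological_space \<Rightarrow> 'b"
  shows "continuous_map euclidean (discrete_topology A) \<beta> \<longleftrightarrow>
    range \<beta> \<subseteq> A \<and> (\<forall>i. open (\<beta> -` {i}))"
proof
  assume L: "continuous_map euclidean (discrete_topology A) \<beta>"
  then have sub: "range \<beta> \<subseteq> A"
    by (auto simp: continuous_map_def)
  have "open (\<beta> -` {i})" for i
  proof (cases "i \<in> A")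
    case True
    then have "openin euclidean {x \<in> topspace euclidean. \<beta> x \<in> {i}}"
      using L unfolding continuous_map_def by (metis empty_subsetI insert_subset openin_discrete_topology)
    then show ?thesis by (simp add: vimage_def)
  next
    case False
    then have "\<beta> -` {i} = {}" using sub by auto
    then show ?thesis by simp
  qed
  with sub show "range \<beta> \<subseteq> A \<and> (\<forall>i. open (\<beta> -` {i}))" by blast
next
  assume R: "range \<beta> \<subseteq> A \<and> (\<forall>i. open (\<beta> -` {i}))"
  have "open {x. \<beta> x \<in> U}" for U
  proof -
    have "{x. \<beta> x \<in> U} = (\<Union>i\<in>U. \<beta> -` {i})" by auto
    then show ?thesis using R by auto
  qed
  with R show "continuous_map euclidean (discrete_topology A) \<beta>"
    by (auto simp: continuous_map_def)
qed

lemma locally_constant_on_compact_uniform: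
  fixes \<beta> :: "'a::metric_space \<Rightarrow> 'b"
  assumes "compact (UNIV :: 'a set)" "continuous_map euclidean (discrete_topology A) \<beta>"
  obtains \<delta> where "\<delta> > 0" "\<And>x y. dist x y < \<delta> \<Longrightarrow> \<beta> x = \<beta> y"
proof -
  have "UNIV \<subseteq> \<Union>(range (\<lambda>i. \<beta> -` {i}))" by auto
  moreover have "\<And>G. G \<in> range (\<lambda>i. \<beta> -` {i}) \<Longrightarrow> open G"
    using assms(2) by (auto simp: continuous_map_discrete_iff_open_fibres)
  ultimately obtain e where e: "e > 0"
    "\<And>x. x \<in> UNIV \<Longrightarrow> \<exists>G\<in>range (\<lambda>i. \<beta> -` {i}). ball x e \<subseteq> G"
    using Heine_Borel_lemma[OF assms(1)] by metis
  have "\<beta> x = \<beta> y" if "dist x y < e" for x y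
  proof -
    obtain i where "ball x e \<subseteq> \<beta> -` {i}" using e(2)[of x] by auto
    moreover have "x \<in> ball x e" "y \<in> ball x e" using that e(1) by auto
    ultimately show ?thesis by blast
  qed
  with e(1) show ?thesis by (rule that)
qed

text \<open>
  A map constant on balls of radius \<open>\<delta>\<close> is determined by its values on a finite \<open>\<delta>\<close>-net.
\<close>

lemma finite_maps_with_common_modulus:
  assumes "compact (UNIV :: 'a::metric_space set)" "finite A" "\<delta> > 0"
  shows "finite {\<alpha> :: 'a \<Rightarrow> 'b. range \<alpha> \<subseteq> A \<and> (\<forall>x y. dist x y < \<delta> \<longrightarrow> \<alpha> x = \<alpha> y)}"
    (is "finite ?M")
proof -
  obtain K :: "'a set" where K: "finite K" "UNIV \<subseteq> (\<Union>x\<in>K. ball x \<delta>)"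
    using assms(1,3) unfolding compact_eq_totally_bounded by blast
  have "(\<lambda>\<alpha>. restrict \<alpha> K) ` ?M \<subseteq> Pi\<^sub>E K (\<lambda>_. A)" by auto
  moreover have "finite (Pi\<^sub>E K (\<lambda>_. A))" using K(1) assms(2) by (intro finite_PiE)
  moreover have "inj_on (\<lambda>\<alpha>. restrict \<alpha> K) ?M"
  proof (rule inj_onI, rule ext)
    fix \<alpha> \<alpha>' x
    assume \<alpha>: "\<alpha> \<in> ?M" "\<alpha>' \<in> ?M" "restrict \<alpha> K = restrict \<alpha>' K"
    have "x \<in> (\<Union>c\<in>K. ball c \<delta>)" using K(2) by blast
    then obtain c where c: "c \<in> K" "dist c x < \<delta>" by auto
    have "\<alpha> c = \<alpha>' c" using fun_cong[OF \<alpha>(3), of c] c(1) by simp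
    moreover have "\<alpha> c = \<alpha> x" "\<alpha>' c = \<alpha>' x" using \<alpha>(1,2) c(2) by simp_all
    ultimately show "\<alpha> x = \<alpha>' x" by simp
  qed
  ultimately show ?thesis by (meson finite_imageD finite_subset)
qed

lemma is_system_graph:
  fixes f :: "'a::metric_space \<Rightarrow> 'a"
  assumes "compact (UNIV :: 'a set)" "continuous_on UNIV f" "surj f"
  shows "is_system euclidean (graph_on UNIV f)"
proof -
  have "continuous_on UNIV (\<lambda>z :: 'a \<times> 'a. f (fst z))"
    by (intro continuous_on_compose2[OF assms(2)] continuous_intros) auto
  then have "closed {z. f (fst z) = snd z}"
    by (intro closed_Collect_eq continuous_intros)
  moreover have "{z. f (fst z) = snd z} = graph_on UNIV f"
    by (auto simp: graph_on_def)
  moreover have "fst ` graph_on UNIV f = UNIV"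
    by (force simp: graph_on_def)
  moreover have "snd ` graph_on UNIV f = UNIV"
    using assms(3) by (force simp: graph_on_def surj_def)
  ultimately show ?thesis
    using assms(1) by (simp add: is_system_def metrizable_space_euclidean compact_space_def)
qed

text \<open>
  For a continuous surjection \<open>f\<close> the condition depends on \<open>f\<close> only through
  \<open>\<beta> \<circ> f\<close>; this is what makes it stable under uniformly small changes of \<open>f\<close>.
\<close>

lemma system_surjection_graph_iff:
  fixes f :: "'a::metric_space \<Rightarrow> 'a"
  assumes "compact (UNIV :: 'a set)" "continuous_on UNIV f" "surj f"
  shows "system_surjection euclidean (graph_on UNIV f) (discrete_topology A) R \<beta> \<longleftrightarrow>
    is_system (discrete_topology A) R \<and> continuous_map euclidean (discrete_topology A) \<beta> \<and>
    range \<beta> = A \<and> range (\<lambda>x. (\<beta> x, \<beta> (f x))) = R"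
proof -
  have "map_prod \<beta> \<beta> ` graph_on UNIV f = range (\<lambda>x. (\<beta> x, \<beta> (f x)))"
    by (force simp: graph_on_def)
  then show ?thesis
    using is_system_graph[OF assms] by (auto simp: system_surjection_def)
qed

section \<open>The lifting property is a countable intersection of open conditions\<close>

lemma openin_system_surjection:
  fixes A :: "'b set" and R :: "('b \<times> 'b) set" and \<beta> :: "'a::metric_space \<Rightarrow> 'b"
  assumes "compact (UNIV :: 'a set)"
  defines "P \<equiv> \<lambda>f :: 'a \<Rightarrow>\<^sub>C 'a. system_surjection euclidean (graph_on UNIV (apply_bcontfun f))
             (discrete_topology A) R \<beta>"
  shows "openin (top_of_set continuous_surjections) {f \<in> continuous_surjections. P f}"
    and "openin (top_of_set continuous_surjections) {f \<in> continuous_surjections. \<not> P f}"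
proof -
  have P_iff: "P f \<longleftrightarrow> is_system (discrete_topology A) R \<and>
      continuous_map euclidean (discrete_topology A) \<beta> \<and>
      range \<beta> = A \<and> range (\<lambda>x. (\<beta> x, \<beta> (apply_bcontfun f x))) = R"
    if "f \<in> continuous_surjections" for f
    unfolding P_def using that
    by (intro system_surjection_graph_iff assms(1)) (auto simp: continuous_surjections_def)
  have "\<exists>\<delta>>0. \<forall>f\<in>continuous_surjections. \<forall>g\<in>continuous_surjections.
          dist g f < \<delta> \<longrightarrow> P g = P f"
  proof (cases "continuous_map euclidean (discrete_topology A) \<beta>")
    case True
    then obtain \<delta> where \<delta>: "\<delta> > 0" "\<And>x y. dist x y < \<delta> \<Longrightarrow> \<beta> x = \<beta> y"
      using locally_constant_on_compact_uniform[OF assms(1)] by metis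
    have "P g = P f" if "f \<in> continuous_surjections" "g \<in> continuous_surjections" "dist g f < \<delta>"
      for f g
    proof -
      have "\<beta> (apply_bcontfun g x) = \<beta> (apply_bcontfun f x)" for x
        using that(3) by (intro \<delta>(2) dist_fun_lt_imp_dist_val_lt)
      then show ?thesis using that(1,2) by (simp add: P_iff)
    qed
    with \<delta>(1) show ?thesis by blast
  next
    case False
    then show ?thesis by (intro exI[of _ 1]) (auto simp: P_iff)
  qed
  then show "openin (top_of_set continuous_surjections) {f \<in> continuous_surjections. P f}"
    and "openin (top_of_set continuous_surjections) {f \<in> continuous_surjections. \<not> P f}"
    unfolding openin_euclidean_subtopology_iff by blast+
qed

text \<open>
  Only countably many accuracies and levels matter. The maps \<open>\<alpha>\<close> onto a given level are sorted
  by a modulus of local constancy \<open>1 / (j + 1)\<close>: each class is finite, so requiring a lift for all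
  its members is a finite intersection of open conditions on \<open>f\<close>.
\<close>

lemma gdelta_in_lifting_property:
  fixes I :: "nat \<Rightarrow> 'b set"
  assumes comp: "compact (UNIV :: 'a::metric_space set)"
    and fin: "\<And>n. n \<ge> 1 \<Longrightarrow> finite (I n)"
  shows "gdelta_in (top_of_set (continuous_surjections :: ('a \<Rightarrow>\<^sub>C 'a) set))
    {f \<in> continuous_surjections. lifting_property I \<phi> p (apply_bcontfun f)}"
proof -
  let ?C = "continuous_surjections :: ('a \<Rightarrow>\<^sub>C 'a) set"
  define P where "P n \<beta> f \<longleftrightarrow> system_surjection euclidean (graph_on UNIV (apply_bcontfun f))
    (discrete_topology (I n)) (\<phi> n) \<beta>" for n \<beta> and f :: "'a \<Rightarrow>\<^sub>C 'a"
  define M where "M n j = {\<alpha> :: 'a \<Rightarrow> 'b. range \<alpha> \<subseteq> I n \<and>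
    (\<forall>x y. dist x y < 1 / real (Suc j) \<longrightarrow> \<alpha> x = \<alpha> y)}" for n j
  define N where "N n k \<alpha> = {(m, \<beta>). m > n \<and> \<alpha> = bond p m n \<circ> \<beta> \<and>
    mesh \<beta> < 1 / real (Suc k)}" for n k and \<alpha> :: "'a \<Rightarrow> 'b"
  define G where "G n k j =
    (\<Inter>\<alpha>\<in>M n j. {f \<in> ?C. \<not> P n \<alpha> f} \<union> (\<Union>(m, \<beta>)\<in>N n k \<alpha>. {f \<in> ?C. P m \<beta> f})) \<inter> ?C"
    for n k j
  have G: "openin (top_of_set ?C) (G n k j)" if "n \<ge> 1" for n k j
  proof -
    have "finite (M n j)"
      unfolding M_def by (rule finite_maps_with_common_modulus[OF comp fin[OF that]]) simp
    moreover have "openin (top_of_set ?C)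
        ({f \<in> ?C. \<not> P n \<alpha> f} \<union> (\<Union>(m, \<beta>)\<in>N n k \<alpha>. {f \<in> ?C. P m \<beta> f}))" for \<alpha>
      unfolding P_def
      by (intro openin_Un openin_Union ballI) (auto intro: openin_system_surjection[OF comp])
    ultimately have "openin (top_of_set ?C)
        ((\<Inter>\<alpha>\<in>M n j. {f \<in> ?C. \<not> P n \<alpha> f} \<union> (\<Union>(m, \<beta>)\<in>N n k \<alpha>. {f \<in> ?C. P m \<beta> f}))
          \<inter> topspace (top_of_set ?C))"
      by (intro openin_INT)
    then show ?thesis by (simp add: G_def)
  qed
  have "{f \<in> ?C. lifting_property I \<phi> p (apply_bcontfun f)} =
      \<Inter>((\<lambda>(n, k, j). G (Suc n) k j) ` UNIV)" (is "?L = ?R")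
  proof (intro equalityI subsetI)
    fix f assume f: "f \<in> ?L"
    have "f \<in> G (Suc n) k j" for n k j
    proof -
      have "\<exists>(m, \<beta>)\<in>N (Suc n) k \<alpha>. P m \<beta> f" if "P (Suc n) \<alpha> f" for \<alpha>
      proof -
        have "(1::real) / real (Suc k) > 0" "Suc n \<ge> 1" by auto
        with f that obtain m \<beta> where "m > Suc n" "P m \<beta> f" "\<alpha> = bond p m (Suc n) \<circ> \<beta>"
            "mesh \<beta> < 1 / real (Suc k)"
          unfolding lifting_property_def P_def by blast
        then show ?thesis unfolding N_def by blast
      qed
      then show ?thesis using f by (fastforce simp: G_def)
    qed
    then show "f \<in> ?R" by auto
  next
    fix f assume f: "f \<in> ?R"
    then have f': "f \<in> G (Suc n) k j" for n k j by auto
    then have fC: "f \<in> ?C" by (auto simp: G_def)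
    have "lifting_property I \<phi> p (apply_bcontfun f)"
      unfolding lifting_property_def P_def[symmetric]
    proof (intro allI impI)
      fix \<epsilon> :: real and n \<alpha>
      assume \<epsilon>: "\<epsilon> > 0" and n: "n \<ge> 1" and \<alpha>: "P n \<alpha> f"
      then have "continuous_map euclidean (discrete_topology (I n)) \<alpha>"
        by (simp add: P_def system_surjection_def)
      then obtain \<delta> where sub: "range \<alpha> \<subseteq> I n"
        and \<delta>: "\<delta> > 0" "\<And>x y. dist x y < \<delta> \<Longrightarrow> \<alpha> x = \<alpha> y"
        using locally_constant_on_compact_uniform[OF comp]
        by (metis continuous_map_discrete_iff_open_fibres)
      obtain j where j: "1 / real (Suc j) < \<delta>" using \<delta>(1) nat_approx_posE by blast
      obtain k where k: "1 / real (Suc k) < \<epsilon>" using \<epsilon> nat_approx_posE by blast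
      have "\<alpha> \<in> M n j" using sub \<delta>(2) j by (auto simp: M_def)
      moreover have "f \<in> G n k j" using f'[of "n - 1"] n by simp
      ultimately obtain m \<beta> where "(m, \<beta>) \<in> N n k \<alpha>" "P m \<beta> f"
        using \<alpha> by (auto simp: G_def)
      then show "\<exists>m>n. \<exists>\<beta>. P m \<beta> f \<and> \<alpha> = bond p m n \<circ> \<beta> \<and> mesh \<beta> < \<epsilon>"
        using k unfolding N_def by force
    qed
    with fC show "f \<in> ?L" by blast
  qed
  also have "gdelta_in (top_of_set ?C) \<dots>"
    by (rule gdelta_in_Inter) (auto intro!: open_imp_gdelta_in G)
  finally show ?thesis .
qed

section \<open>The lifting property is a conjugacy invariant\<close>

lemma system_surjection_transport:
  fixes f g :: "'a::metric_space \<Rightarrow> 'a"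
  assumes "compact (UNIV :: 'a set)" "continuous_on UNIV f" "surj f" "continuous_on UNIV g" "surj g"
    and hk: "homeomorphic_maps euclidean euclidean h k"
    and semi: "\<And>x. g (h x) = h (f x)"
    and \<gamma>: "system_surjection euclidean (graph_on UNIV f) (discrete_topology A) R \<gamma>"
  shows "system_surjection euclidean (graph_on UNIV g) (discrete_topology A) R (\<gamma> \<circ> k)"
proof -
  have kh: "\<And>x. k (h x) = x" and hk': "\<And>x. h (k x) = x" and "continuous_map euclidean euclidean k"
    using hk by (auto simp: homeomorphic_maps_def)
  then have "surj k" by (metis surjI)
  have "surj h" using hk' by (metis surjI)
  have kg: "k (g y) = f (k y)" for y by (metis kh hk' semi)
  note iff = system_surjection_graph_iff[OF assms(1)]
  from \<gamma> have \<gamma>': "is_system (discrete_topology A) R"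
    "continuous_map euclidean (discrete_topology A) \<gamma>"
    "range \<gamma> = A" "range (\<lambda>x. (\<gamma> x, \<gamma> (f x))) = R"
    unfolding iff[OF assms(2,3)] by auto
  have "range (\<gamma> \<circ> k) = A" using \<gamma>'(3) \<open>surj k\<close> by (metis fun.set_map)
  moreover have "range (\<lambda>y. ((\<gamma> \<circ> k) y, (\<gamma> \<circ> k) (g y))) = (\<lambda>x. (\<gamma> x, \<gamma> (f x))) ` range k"
    by (simp add: kg image_image)
  moreover have "continuous_map euclidean (discrete_topology A) (\<gamma> \<circ> k)"
    by (rule continuous_map_compose[OF \<open>continuous_map euclidean euclidean k\<close> \<gamma>'(2)])
  ultimately show ?thesis
    unfolding iff[OF assms(4,5)] using \<gamma>'(1,4) \<open>surj k\<close> by simp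
qed

text \<open>
  Lifting problems and their solutions are moved back and forth by composing with the homeomorphism. The
  accuracy changes on the way, but by compactness only in a uniformly controlled manner.
\<close>

lemma lifting_property_conjugate:
  fixes f g :: "'a::metric_space \<Rightarrow> 'a"
  assumes comp: "compact (UNIV :: 'a set)"
    and f: "continuous_on UNIV f" "surj f" and g: "continuous_on UNIV g" "surj g"
    and hk: "homeomorphic_maps euclidean euclidean h k"
    and semi: "\<And>x. g (h x) = h (f x)"
    and lift: "lifting_property I \<phi> p f"
  shows "lifting_property I \<phi> p g"
  unfolding lifting_property_def
proof (intro allI impI)
  fix \<epsilon> :: real and n \<alpha>
  assume \<epsilon>: "\<epsilon> > 0" and n: "n \<ge> 1"
    and \<alpha>: "system_surjection euclidean (graph_on UNIV g) (discrete_topology (I n)) (\<phi> n) \<alpha>"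
  have hk': "\<And>x. h (k x) = x" "\<And>x. k (h x) = x" "continuous_on UNIV h"
    using hk by (auto simp: homeomorphic_maps_def)
  have semi': "f (k y) = k (g y)" for y by (metis hk'(1,2) semi)
  \<comment> \<open>Uniform continuity of the homeomorphism controls the mesh of the transported lift.\<close>
  have "uniformly_continuous_on UNIV h" by (rule compact_uniformly_continuous[OF hk'(3) comp])
  moreover have "\<epsilon> / 2 > 0" using \<epsilon> by simp
  ultimately obtain \<delta> where "\<delta> > 0"
      and unif: "\<forall>x\<in>UNIV. \<forall>x'\<in>UNIV. dist x' x < \<delta> \<longrightarrow> dist (h x') (h x) < \<epsilon> / 2"
    unfolding uniformly_continuous_on_def by meson
  then have \<delta>: "dist x y < \<delta> \<Longrightarrow> dist (h x) (h y) < \<epsilon> / 2" for x y by simp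
  have "homeomorphic_maps euclidean euclidean k h"
    using hk by (rule homeomorphic_maps_sym[THEN iffD1])
  from system_surjection_transport[OF comp g f this semi' \<alpha>]
  have "system_surjection euclidean (graph_on UNIV f) (discrete_topology (I n)) (\<phi> n) (\<alpha> \<circ> h)" .
  then obtain m \<beta> where m: "m > n"
    and \<beta>: "system_surjection euclidean (graph_on UNIV f) (discrete_topology (I m)) (\<phi> m) \<beta>"
    and eq: "\<alpha> \<circ> h = bond p m n \<circ> \<beta>" and mesh: "mesh \<beta> < \<delta>"
    using lift n \<open>\<delta> > 0\<close> unfolding lifting_property_def by blast
  have "system_surjection euclidean (graph_on UNIV g) (discrete_topology (I m)) (\<phi> m) (\<beta> \<circ> k)"
    by (rule system_surjection_transport[OF comp f g hk semi \<beta>])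
  moreover have "\<alpha> = bond p m n \<circ> (\<beta> \<circ> k)"
  proof
    fix x show "\<alpha> x = (bond p m n \<circ> (\<beta> \<circ> k)) x"
      using fun_cong[OF eq, of "k x"] by (simp add: hk')
  qed
  moreover have "mesh (\<beta> \<circ> k) \<le> \<epsilon> / 2"
  proof (rule mesh_leI)
    fix x y assume "(\<beta> \<circ> k) x = (\<beta> \<circ> k) y"
    then have "dist (k x) (k y) < \<delta>"
      by (intro mesh_less_imp_dist_less[OF comp mesh]) simp
    from \<delta>[OF this] show "dist x y \<le> \<epsilon> / 2" by (simp add: hk')
  qed
  ultimately show "\<exists>m>n. \<exists>\<beta>. system_surjection euclidean (graph_on UNIV g)
      (discrete_topology (I m)) (\<phi> m) \<beta> \<and> \<alpha> = bond p m n \<circ> \<beta> \<and> mesh \<beta> < \<epsilon>"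
    using m \<epsilon> by (intro exI[of _ m] conjI exI[of _ "\<beta> \<circ> k"]) auto
qed

lemma conjugate_to_same_imp_conjugate:
  assumes f: "conjugate_to euclidean f Y G" and g: "conjugate_to euclidean g Y G"
  obtains h k where "homeomorphic_maps euclidean euclidean h k" "\<And>x. g (h x) = h (f x)"
proof -
  obtain h1 k1 where 1: "homeomorphic_maps euclidean Y h1 k1"
    "G = graph_on (topspace Y) (h1 \<circ> f \<circ> k1)"
    using f unfolding conjugate_to_def by blast
  obtain h2 k2 where 2: "homeomorphic_maps euclidean Y h2 k2"
    "G = graph_on (topspace Y) (h2 \<circ> g \<circ> k2)"
    using g unfolding conjugate_to_def by blast
  have Y: "h1 x \<in> topspace Y" for x using 1(1) by (auto simp: homeomorphic_maps_def continuous_map_def)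
  have eq: "h1 (f (k1 y)) = h2 (g (k2 y))" if "y \<in> topspace Y" for y
  proof -
    have "(y, h1 (f (k1 y))) \<in> G" using 1(2) that by (auto simp: graph_on_def)
    then show ?thesis using 2(2) by (auto simp: graph_on_def)
  qed
  have "homeomorphic_maps euclidean euclidean (k2 \<circ> h1) (k1 \<circ> h2)"
    using homeomorphic_maps_compose 1(1) 2(1) homeomorphic_maps_sym by blast
  moreover have "g ((k2 \<circ> h1) x) = (k2 \<circ> h1) (f x)" for x
    using eq[OF Y[of x]] 1(1) 2(1) by (simp add: homeomorphic_maps_def)
  ultimately show ?thesis by (rule that)
qed

section \<open>A tower of lifts identifies the space with the inverse limit\<close>

lemma bond_self [simp]: "bond p n n = id"
  by (cases n) auto

lemma bond_compose:
  assumes "n \<le> m" "m \<le> l"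
  shows "bond p l n = bond p m n \<circ> bond p l m"
  using assms(2)
proof (induction l rule: dec_induct)
  case (step l)
  then show ?case using assms(1) by (auto simp: comp_assoc)
qed simp

lemma inverse_limit_set_subset_PiE: "inverse_limit_set I p \<subseteq> Pi\<^sub>E {1..} I"
  unfolding inverse_limit_set_def by (rule Collect_restrict)

lemma inverse_limit_set_undefined:
  assumes "z \<in> inverse_limit_set I p" "\<not> 1 \<le> n"
  shows "z n = undefined"
  using assms inverse_limit_set_subset_PiE[of I p] PiE_arb[of z "{1..}" I n] by auto

lemma bond_inverse_limit:
  assumes "z \<in> inverse_limit_set I p" "1 \<le> n" "n \<le> m"
  shows "bond p m n (z m) = z n"
  using assms(3)
proof (induction m rule: dec_induct)
  case (step m)
  have "z m = p m (z (Suc m))"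
    using assms(1,2) step(1) unfolding inverse_limit_set_def mem_Collect_eq Suc_eq_plus1
    by (meson le_trans)
  then show ?case using step by simp
qed simp

lemma bond_system:
  assumes sys: "\<And>n. n \<ge> 1 \<Longrightarrow> system_surjection (discrete_topology (I (n + 1))) (\<phi> (n + 1))
              (discrete_topology (I n)) (\<phi> n) (p n)"
    and "1 \<le> n" "n \<le> m"
  shows "bond p m n \<in> I m \<rightarrow> I n"
    and "(a, b) \<in> \<phi> m \<Longrightarrow> (bond p m n a, bond p m n b) \<in> \<phi> n"
proof -
  have "bond p m n \<in> I m \<rightarrow> I n \<and> (\<forall>a b. (a, b) \<in> \<phi> m \<longrightarrow> (bond p m n a, bond p m n b) \<in> \<phi> n)"
    using assms(3)
  proof (induction m rule: dec_induct)
    case (step m)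
    have "p m ` I (Suc m) = I m" "map_prod (p m) (p m) ` \<phi> (Suc m) = \<phi> m"
      using sys[of m] step(1) assms(2) by (auto simp: system_surjection_def)
    then have "p m a \<in> I m" if "a \<in> I (Suc m)" for a
      using that by blast
    moreover have "(p m a, p m b) \<in> \<phi> m" if "(a, b) \<in> \<phi> (Suc m)" for a b
      using that \<open>map_prod (p m) (p m) ` \<phi> (Suc m) = \<phi> m\<close> by force
    ultimately show ?case using step by (auto simp: Pi_iff)
  qed simp
  then show "bond p m n \<in> I m \<rightarrow> I n"
    and "(a, b) \<in> \<phi> m \<Longrightarrow> (bond p m n a, bond p m n b) \<in> \<phi> n" by blast+
qed

text \<open>
  By the Shimomura Condition, the coordinate of an image at level \<open>n\<close> is a function of the
  coordinate of the argument at some higher level \<open>m\<close>.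
\<close>

lemma inverse_limit_relation_single_valued:
  assumes shim: "\<And>n. n \<ge> 1 \<Longrightarrow> \<exists>m>n. \<exists>g \<in> I m \<rightarrow> I n.
        {(a, bond p m n b) | a b. (a, b) \<in> \<phi> m} = graph_on (I m) g"
    and "(z, w) \<in> inverse_limit_relation I \<phi> p" "(z, w') \<in> inverse_limit_relation I \<phi> p"
  shows "w = w'"
proof
  fix n
  have w: "w \<in> inverse_limit_set I p" "w' \<in> inverse_limit_set I p"
    "\<And>m. m \<ge> 1 \<Longrightarrow> (z m, w m) \<in> \<phi> m \<and> (z m, w' m) \<in> \<phi> m"
    using assms(2,3) by (auto simp: inverse_limit_relation_def)
  show "w n = w' n"
  proof (cases "n \<ge> 1")
    case True
    then obtain m g where m: "m > n"
      and g: "{(a, bond p m n b) | a b. (a, b) \<in> \<phi> m} = graph_on (I m) g"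
      using shim by blast
    have "(z m, bond p m n (w m)) \<in> graph_on (I m) g" "(z m, bond p m n (w' m)) \<in> graph_on (I m) g"
      unfolding g[symmetric] using w(3)[of m] m True by auto
    then have "bond p m n (w m) = bond p m n (w' m)" by (auto simp: graph_on_def)
    then show ?thesis using w(1,2) m True by (simp add: bond_inverse_limit)
  next
    case False
    then show ?thesis
      using w(1,2) by (simp add: inverse_limit_set_undefined)
  qed
qed

text \<open>
  The lifting property only refines a labelling that is already given. A singleton at level
  \<open>1\<close> supplies the first one, the constant map; its only possible transition is the loop at the
  single point.
\<close>

lemma obtain_tower_of_lifts:
  fixes f :: "'a::metric_space \<Rightarrow> 'a"
  assumes comp: "compact (UNIV :: 'a set)" and f: "continuous_on UNIV f" "surj f"
    and sys1: "is_system (discrete_topology (I 1)) (\<phi> 1)" and "is_singleton (I 1)"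
    and lift: "lifting_property I \<phi> p f"
  obtains \<nu> :: "nat \<Rightarrow> nat" and \<beta> :: "nat \<Rightarrow> 'a \<Rightarrow> 'b" where
    "\<And>k. \<nu> k < \<nu> (Suc k)" "\<And>k. k < \<nu> k"
    "\<And>k. system_surjection euclidean (graph_on UNIV f) (discrete_topology (I (\<nu> k))) (\<phi> (\<nu> k)) (\<beta> k)"
    "\<And>k. \<beta> k = bond p (\<nu> (Suc k)) (\<nu> k) \<circ> \<beta> (Suc k)"
    "\<And>k. mesh (\<beta> (Suc k)) < 1 / real (Suc k)"
proof -
  define P where "P m \<beta> \<longleftrightarrow> system_surjection euclidean (graph_on UNIV f)
    (discrete_topology (I m)) (\<phi> m) \<beta>" for m \<beta>
  obtain c where c: "I 1 = {c}" using \<open>is_singleton (I 1)\<close> by (auto elim: is_singletonE)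
  have "\<phi> 1 = {(c, c)}"
  proof -
    have "fst ` \<phi> 1 = {c}" "snd ` \<phi> 1 = {c}" using sys1 c by (auto simp: is_system_def)
    then have "q = (c, c)" if "q \<in> \<phi> 1" for q
      using that by (cases q) force
    moreover have "\<phi> 1 \<noteq> {}" using \<open>fst ` \<phi> 1 = {c}\<close> by blast
    ultimately show ?thesis by blast
  qed
  then have base: "P 1 (\<lambda>_. c)"
    unfolding P_def system_surjection_graph_iff[OF comp f] using sys1 c by auto
  let ?A = "\<lambda>k (m, \<beta>). m > k \<and> P m \<beta>"
  let ?B = "\<lambda>k (m, \<beta>) (m', \<beta>'). m < m' \<and> \<beta> = bond p m' m \<circ> \<beta>' \<and> mesh \<beta>' < 1 / real (Suc k)"
  have "\<exists>s. \<forall>k. ?A k (s k) \<and> ?B k (s k) (s (Suc k))"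
  proof (rule dependent_nat_choice)
    show "\<exists>x. ?A 0 x" using base by (intro exI[of _ "(1, \<lambda>_. c)"]) simp
  next
    fix x k assume A: "?A k x"
    obtain m \<beta> where x: "x = (m, \<beta>)" by (cases x)
    then have "m > k" "m \<ge> 1" "P m \<beta>" using A by auto
    moreover have "1 / real (Suc k) > 0" by simp
    ultimately obtain m' \<beta>' where y: "m' > m" "P m' \<beta>'" "\<beta> = bond p m' m \<circ> \<beta>'"
        "mesh \<beta>' < 1 / real (Suc k)"
      using lift[unfolded lifting_property_def, rule_format, of "1 / real (Suc k)" m \<beta>]
      unfolding P_def by blast
    have "?A (Suc k) (m', \<beta>') \<and> ?B k x (m', \<beta>')"
      unfolding x prod.case using y \<open>m > k\<close> by (intro conjI) (linarith | assumption)+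
    then show "\<exists>y. ?A (Suc k) y \<and> ?B k x y" by (rule exI)
  qed
  then obtain s where s: "\<forall>k. ?A k (s k) \<and> ?B k (s k) (s (Suc k))" ..
  show ?thesis
  proof (rule that[of "\<lambda>k. fst (s k)" "\<lambda>k. snd (s k)"])
    fix k
    have sk: "(k < fst (s k) \<and> P (fst (s k)) (snd (s k))) \<and> fst (s k) < fst (s (Suc k)) \<and>
        snd (s k) = bond p (fst (s (Suc k))) (fst (s k)) \<circ> snd (s (Suc k)) \<and>
        mesh (snd (s (Suc k))) < 1 / real (Suc k)"
      using s[rule_format, of k] unfolding case_prod_unfold .
    note sk' = sk[THEN conjunct1] sk[THEN conjunct2]
    show "fst (s k) < fst (s (Suc k))" by (rule sk'(2)[THEN conjunct1])
    show "k < fst (s k)" by (rule sk'(1)[THEN conjunct1])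
    show "system_surjection euclidean (graph_on UNIV f)
        (discrete_topology (I (fst (s k)))) (\<phi> (fst (s k))) (snd (s k))"
      by (rule sk'(1)[THEN conjunct2, unfolded P_def])
    show "snd (s k) = bond p (fst (s (Suc k))) (fst (s k)) \<circ> snd (s (Suc k))"
      by (rule sk'(2)[THEN conjunct2, THEN conjunct1])
    show "mesh (snd (s (Suc k))) < 1 / real (Suc k)"
      by (rule sk'(2)[THEN conjunct2, THEN conjunct2])
  qed
qed

text \<open>
  The labels of a point at the levels of the tower determine a thread of the inverse limit. Labels at
  all levels determine the point, because the cells shrink, and every thread comes from a point, because
  its cells are nested, nonempty and compact. Since \<open>f\<close> is only known to map into the limit
  relation, single-valuedness of the latter is what gives equality of graphs.
\<close>

lemma lifting_imp_conjugate_to_inverse_limit: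
  fixes f :: "'a::metric_space \<Rightarrow> 'a" and I :: "nat \<Rightarrow> 'b set"
  assumes comp: "compact (UNIV :: 'a set)" and f: "continuous_on UNIV f" "surj f"
    and sys: "\<And>n. n \<ge> 1 \<Longrightarrow> system_surjection (discrete_topology (I (n + 1))) (\<phi> (n + 1))
              (discrete_topology (I n)) (\<phi> n) (p n)"
    and shim: "\<And>n. n \<ge> 1 \<Longrightarrow> \<exists>m>n. \<exists>g \<in> I m \<rightarrow> I n.
        {(a, bond p m n b) | a b. (a, b) \<in> \<phi> m} = graph_on (I m) g"
    and pointed: "is_singleton (I 1)"
    and lift: "lifting_property I \<phi> p f"
  shows "conjugate_to euclidean f (inverse_limit_topology I p) (inverse_limit_relation I \<phi> p)"
proof -
  have "is_system (discrete_topology (I 1)) (\<phi> 1)"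
    using sys[of 1] unfolding system_surjection_def by blast
  then show ?thesis
  proof (rule obtain_tower_of_lifts[OF comp f _ pointed lift])
    fix \<nu> \<beta>
    assume \<nu>_step: "\<And>k. \<nu> k < \<nu> (Suc k)" and \<nu>_gt: "\<And>k. k < \<nu> k"
      and ss: "\<And>k. system_surjection euclidean (graph_on UNIV f)
         (discrete_topology (I (\<nu> k))) (\<phi> (\<nu> k)) (\<beta> k)"
      and \<beta>_step: "\<And>k. \<beta> k = bond p (\<nu> (Suc k)) (\<nu> k) \<circ> \<beta> (Suc k)"
      and mesh: "\<And>k. mesh (\<beta> (Suc k)) < 1 / real (Suc k)"
    have \<beta>_cont: "continuous_map euclidean (discrete_topology (I (\<nu> k))) (\<beta> k)"
      and \<beta>_range: "range (\<beta> k) = I (\<nu> k)"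
      and \<beta>_rel: "(\<beta> k x, \<beta> k (f x)) \<in> \<phi> (\<nu> k)" for k x
      using ss[of k] unfolding system_surjection_graph_iff[OF comp f] by auto
    have \<nu>_mono: "\<nu> k \<le> \<nu> l" if "k \<le> l" for k l
      using lift_Suc_mono_le[of \<nu>, OF _ that] \<nu>_step less_imp_le by blast
    have tower: "bond p (\<nu> l) (\<nu> k) (\<beta> l x) = \<beta> k x" if "k \<le> l" for k l x
      using that
    proof (induction l rule: dec_induct)
      case (step l)
      have "bond p (\<nu> (Suc l)) (\<nu> k) = bond p (\<nu> l) (\<nu> k) \<circ> bond p (\<nu> (Suc l)) (\<nu> l)"
        using step(1) by (intro bond_compose \<nu>_mono) auto
      then show ?case using step.IH fun_cong[OF \<beta>_step[of l], of x] by simp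
    qed simp
    \<comment> \<open>As \<open>\<nu> n > n\<close>, the \<open>n\<close>-th lift already determines the \<open>n\<close>-th coordinate.\<close>
    define h where "h x = restrict (\<lambda>n. bond p (\<nu> n) n (\<beta> n x)) {1..}" for x
    have h_eq: "h x n = bond p (\<nu> l) n (\<beta> l x)" if "1 \<le> n" "n \<le> \<nu> k" "k \<le> l" "n \<le> l" for x n k l
      using tower[OF \<open>n \<le> l\<close>, of x] \<nu>_gt[of n] that bond_compose[of n "\<nu> n" "\<nu> l" p] \<nu>_mono[of n l]
      by (simp add: h_def)
    have h_\<nu>: "h x (\<nu> k) = \<beta> k x" for x k
      using h_eq[of "\<nu> k" "\<nu> k" "\<nu> k" x] tower[of k "\<nu> k" x] \<nu>_gt[of k] \<nu>_gt[of "\<nu> k"] by simp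
    have h_in: "h x \<in> inverse_limit_set I p" for x
    proof -
      have h_I: "h x n \<in> I n" if "n \<ge> 1" for n
        using bond_system(1)[where I = I and \<phi> = \<phi> and p = p, OF sys that, of "\<nu> n"]
          \<nu>_gt[of n] \<beta>_range[of n] that
        by (auto simp: h_def Pi_iff)
      have "h x n = p n (h x (n + 1))" if "n \<ge> 1" for n
      proof -
        have "h x n = bond p (\<nu> (Suc n)) n (\<beta> (Suc n) x)"
          using that \<nu>_gt[of n] by (intro h_eq[of _ n]) auto
        also have "\<dots> = bond p (Suc n) n (bond p (\<nu> (Suc n)) (Suc n) (\<beta> (Suc n) x))"
          using bond_compose[of n "Suc n" "\<nu> (Suc n)" p] \<nu>_gt[of "Suc n"] by simp
        also have "\<dots> = p n (h x (n + 1))" by (simp add: h_def)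
        finally show ?thesis .
      qed
      moreover have "h x \<in> Pi\<^sub>E {1..} I"
        using h_I by (auto simp: h_def)
      ultimately show ?thesis unfolding inverse_limit_set_def by blast
    qed
    have top: "topspace (inverse_limit_topology I p) = inverse_limit_set I p"
      using inverse_limit_set_subset_PiE[of I p]
      by (simp add: inverse_limit_topology_def Int_absorb1)
    have "continuous_map euclidean (inverse_limit_topology I p) h"
      unfolding inverse_limit_topology_def continuous_map_in_subtopology continuous_map_componentwise
    proof (intro conjI ballI)
      fix n :: nat assume n: "n \<in> {1..}"
      have "continuous_map (discrete_topology (I (\<nu> n))) (discrete_topology (I n)) (bond p (\<nu> n) n)"
        using bond_system(1)[where I = I and \<phi> = \<phi> and p = p, OF sys, of n "\<nu> n"] n \<nu>_gt[of n]
        by (auto simp: Pi_iff)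
      from continuous_map_compose[OF \<beta>_cont this]
      show "continuous_map euclidean (discrete_topology (I n)) (\<lambda>x. h x n)"
        using n by (simp add: h_def comp_def)
    qed (use h_in in \<open>auto simp: h_def\<close>)
    moreover have "inj h"
    proof (rule injI, rule ccontr)
      fix x y assume eq: "h x = h y" and "x \<noteq> y"
      then obtain k where k: "1 / real (Suc k) < dist x y"
        using nat_approx_posE[of "dist x y"] by auto
      have "\<beta> (Suc k) x = \<beta> (Suc k) y" using eq h_\<nu>[of x "Suc k"] h_\<nu>[of y "Suc k"] by simp
      from mesh_less_imp_dist_less[OF comp mesh this] k show False by simp
    qed
    moreover have "range h = inverse_limit_set I p"
    proof (intro equalityI subsetI)
      fix z assume z: "z \<in> inverse_limit_set I p"
      \<comment> \<open>A preimage of \<open>z\<close> is a common point of the decreasing closed fibres over its coordinates.\<close>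
      let ?F = "\<lambda>k. \<beta> k -` {z (\<nu> k)}"
      have "(\<Inter>k. ?F k) \<noteq> {}"
      proof (rule compact_space_imp_nest)
        show "compact_space (euclidean :: 'a topology)" using comp by (simp add: compact_space_def)
        show "closedin euclidean (?F k)" for k
        proof -
          have "- ?F k = (\<Union>i\<in>-{z (\<nu> k)}. \<beta> k -` {i})" by auto
          then show ?thesis
            using \<beta>_cont[of k] by (auto simp: continuous_map_discrete_iff_open_fibres closed_def)
        qed
        show "?F k \<noteq> {}" for k
        proof -
          have "\<nu> k \<ge> 1" using \<nu>_gt[of k] by simp
          then have "z (\<nu> k) \<in> range (\<beta> k)"
            using z \<beta>_range[of k] inverse_limit_set_subset_PiE[of I p]
            by (metis PiE_mem atLeast_iff subsetD)
          then show ?thesis by auto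
        qed
        show "decseq ?F"
        proof (intro decseq_SucI subsetI)
          fix k x assume "x \<in> ?F (Suc k)"
          moreover have "1 \<le> \<nu> k" using \<nu>_gt[of k] by simp
          ultimately show "x \<in> ?F k"
            using tower[of k "Suc k" x] bond_inverse_limit[OF z, of "\<nu> k" "\<nu> (Suc k)"] \<nu>_step[of k]
            by simp
        qed
      qed
      then obtain x where "x \<in> (\<Inter>k. ?F k)" by blast
      then have x: "\<beta> k x = z (\<nu> k)" for k by simp
      have "h x n = z n" for n
      proof (cases "n \<ge> 1")
        case True
        then show ?thesis
          using x bond_inverse_limit[OF z True, of "\<nu> n"] \<nu>_gt[of n] by (simp add: h_def)
      next
        case False
        then show ?thesis using z h_in[of x] by (simp add: inverse_limit_set_undefined)
      qed
      then show "z \<in> range h" by (metis ext rangeI)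
    qed (use h_in in auto)
    moreover have "Hausdorff_space (inverse_limit_topology I p)"
      unfolding inverse_limit_topology_def
      by (intro Hausdorff_space_subtopology) (simp add: Hausdorff_space_product_topology)
    ultimately have "homeomorphic_map euclidean (inverse_limit_topology I p) h"
      using comp by (intro continuous_imp_homeomorphic_map) (auto simp: top compact_space_def)
    then obtain k where hk: "homeomorphic_maps euclidean (inverse_limit_topology I p) h k"
      using homeomorphic_map_maps by blast
    have h_rel: "(h x, h (f x)) \<in> inverse_limit_relation I \<phi> p" for x
    proof -
      have "(h x n, h (f x) n) \<in> \<phi> n" if "1 \<le> n" for n
        using bond_system(2)[where I = I and \<phi> = \<phi> and p = p, OF sys that _ \<beta>_rel] \<nu>_gt[of n] that
        by (simp add: h_def)
      then show ?thesis using h_in by (simp add: inverse_limit_relation_def)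
    qed
    have "inverse_limit_relation I \<phi> p =
        graph_on (topspace (inverse_limit_topology I p)) (h \<circ> f \<circ> k)"
    proof (intro equalityI subsetI)
      fix q assume q: "q \<in> inverse_limit_relation I \<phi> p"
      obtain z w where zw: "q = (z, w)" by (cases q)
      then have z: "z \<in> topspace (inverse_limit_topology I p)"
        using q by (auto simp: inverse_limit_relation_def top)
      then have "h (k z) = z" using hk by (simp add: homeomorphic_maps_def)
      then have "w = h (f (k z))"
        using inverse_limit_relation_single_valued[OF shim, of z w] q zw h_rel[of "k z"] by simp
      then show "q \<in> graph_on (topspace (inverse_limit_topology I p)) (h \<circ> f \<circ> k)"
        using z zw by (auto simp: graph_on_def)
    next
      fix q assume "q \<in> graph_on (topspace (inverse_limit_topology I p)) (h \<circ> f \<circ> k)"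
      then obtain z where z: "z \<in> topspace (inverse_limit_topology I p)" "q = (z, h (f (k z)))"
        by (auto simp: graph_on_def)
      then have "h (k z) = z" using hk by (simp add: homeomorphic_maps_def)
      then show "q \<in> inverse_limit_relation I \<phi> p" using h_rel[of "k z"] z by simp
    qed
    with hk show ?thesis unfolding conjugate_to_def by blast
  qed
qed

section \<open>The set of maps with the lifting property\<close>

theorem theorem3p17:
  fixes I :: "nat \<Rightarrow> nat list set"
    and \<phi> :: "nat \<Rightarrow> (nat list \<times> nat list) set"
    and p :: "nat \<Rightarrow> nat list \<Rightarrow> nat list"
    and L :: "('a::metric_space \<Rightarrow>\<^sub>C 'a) set"
  assumes "Cantor_space (UNIV :: 'a set)"
    and "pointed_Shimomura_sequence I \<phi> p"
  defines "L \<equiv> {f \<in> continuous_surjections. lifting_property I \<phi> p (apply_bcontfun f)}"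
  shows "gdelta_in (top_of_set continuous_surjections) L \<and>
    (L \<noteq> {} \<longrightarrow>
      L = {f \<in> continuous_surjections.
             conjugate_to euclidean (apply_bcontfun f)
               (inverse_limit_topology I p) (inverse_limit_relation I \<phi> p)})"
proof -
  have comp: "compact (UNIV :: 'a set)"
    using assms(1) by (simp add: Cantor_space_def)
  have fin: "\<And>n. n \<ge> 1 \<Longrightarrow> finite (I n)"
    and sys: "\<And>n. n \<ge> 1 \<Longrightarrow> system_surjection (discrete_topology (I (n + 1))) (\<phi> (n + 1))
              (discrete_topology (I n)) (\<phi> n) (p n)"
    and shim: "\<And>n. n \<ge> 1 \<Longrightarrow> \<exists>m>n. \<exists>g \<in> I m \<rightarrow> I n.
        {(a, bond p m n b) | a b. (a, b) \<in> \<phi> m} = graph_on (I m) g"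
    and pointed: "is_singleton (I 1)"
    using assms(2)
    unfolding pointed_Shimomura_sequence_def Shimomura_sequence_def index_sets_def by blast+
  have surj: "surj (apply_bcontfun f)" if "f \<in> continuous_surjections" for f :: "'a \<Rightarrow>\<^sub>C 'a"
    using that by (simp add: continuous_surjections_def)
  have conj: "conjugate_to euclidean (apply_bcontfun f)
      (inverse_limit_topology I p) (inverse_limit_relation I \<phi> p)" if "f \<in> L" for f
    using that unfolding L_def
    by (intro lifting_imp_conjugate_to_inverse_limit comp surj sys shim pointed) auto
  have "f \<in> L" if f0: "f0 \<in> L" and f: "f \<in> continuous_surjections"
    and cf: "conjugate_to euclidean (apply_bcontfun f)
      (inverse_limit_topology I p) (inverse_limit_relation I \<phi> p)" for f0 f
  proof -
    obtain h k where hk: "homeomorphic_maps euclidean euclidean h k"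
      "\<And>x. apply_bcontfun f (h x) = h (apply_bcontfun f0 x)"
      using conjugate_to_same_imp_conjugate[OF conj[OF f0] cf] by metis
    have "lifting_property I \<phi> p (apply_bcontfun f)"
      by (rule lifting_property_conjugate[where f = "apply_bcontfun f0" and g = "apply_bcontfun f",
            OF comp _ _ _ _ hk])
        (use f0 f surj in \<open>auto simp: L_def\<close>)
    with f show ?thesis by (simp add: L_def)
  qed
  moreover have "L \<subseteq> continuous_surjections" by (auto simp: L_def)
  ultimately have "L \<noteq> {} \<longrightarrow> L = {f \<in> continuous_surjections.
      conjugate_to euclidean (apply_bcontfun f)
        (inverse_limit_topology I p) (inverse_limit_relation I \<phi> p)}"
    using conj by blast
  moreover have "gdelta_in (top_of_set continuous_surjections) L"
    unfolding L_def by (rule gdelta_in_lifting_property[OF comp fin])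
  ultimately show ?thesis by blast
qed

end
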